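(* Let $\mathbf{A}=\langle A,\cdot,\to,\top\rangle$ be a hoop and $\delta\colon A\to A$ a conucleus on $\mathbf{A}$. Let $\mathbf{A}_\delta=\langle \delta(A),\cdot,\to_\delta,\delta(\top)\rangle$ be its conuclear image. The following are equivalent: (i) $\delta(a)=a\cdot\delta(\top)$ for all $a\in A$; (ii) $\delta$ is a homomorphism from $\mathbf{A}$ onto $\mathbf{A}_\delta$. If the equivalent conditions (i) and (ii) hold, then $\mathbf{A}/\ker(\delta)\cong\mathbf{A}_\delta$, and moreover the filter corresponding to the congruence $\ker(\delta)=\{(a,b)\in A^2:\delta(a)=\delta(b)\}$ (that is, the congruence class of $\top$) is the set $\{a\in A:\delta(\top)\le a\}$.
   Context: A hoop is an algebra $\mathbf{A}=\langle A,\cdot,\to,\top\rangle$ such that $\langle A,\cdot,\top\rangle$ is a commutative monoid and $x\to x=\top$, $x\cdot(x\to y)=y\cdot(y\to x)$, $x\to(y\to z)=(x\cdot y)\to z$ for all $x,y,z$. It is partially ordered by $x\le y$ iff $x\to y=\top$; $\top$ is the greatest element. A conucleus on a hoop $\mathbf{A}$ is a map $\delta\colon A\to A$ such that for all $a,b\in A$: $\delta(a)\le a$; $a\le b$ implies $\delta(a)\le\delta(b)$; $\delta(\delta(a))=\delta(a)$; $\delta(a)\cdot\delta(b)\le\delta(a\cdot b)$; $\delta(a)\cdot\delta(\top)=\delta(a)$. The conuclear image is the algebra $\mathbf{A}_\delta=\langle\delta(A),\cdot,\to_\delta,\delta(\top)\rangle$ with $a\to_\delta b:=\delta(a\to b)$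 for $a,b\in\delta(A)$ (the set $\delta(A)$ is closed under $\cdot$; $\mathbf{A}_\delta$ need not be a hoop). Homomorphisms are with respect to the language $\{\cdot,\to,\top\}$, where $\top$ is interpreted in $\mathbf{A}_\delta$ as $\delta(\top)$. A filter of $\mathbf{A}$ is a nonempty upward closed subset closed under $\cdot$; filters correspond to congruences by sending a congruence to the class of $\top$. *)

theory Defs
  imports "HOL-Algebra.Group"
begin

text \<open>
  Algebras in the language of a multiplication, an implication and a constant. The monoid part is
  the record of \<open>HOL-Algebra\<close>; the constant written \<open>\<top>\<close> in the literature on hoops is its \<open>\<one>\<close>.
\<close>

record 'a hoop_algebra = "'a monoid" +
  imp :: "'a \<Rightarrow> 'a \<Rightarrow> 'a"  (infixr \<open>\<leadsto>\<index>\<close> 65)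

definition hoop_le :: "('a, 'm) hoop_algebra_scheme \<Rightarrow> 'a \<Rightarrow> 'a \<Rightarrow> bool"  (infix \<open>\<preceq>\<index>\<close> 50)
  where "x \<preceq>\<^bsub>A\<^esub> y \<longleftrightarrow> x \<leadsto>\<^bsub>A\<^esub> y = \<one>\<^bsub>A\<^esub>"

locale hoop = comm_monoid A for A (structure) +
  assumes imp_closed: "\<lbrakk>x \<in> carrier A; y \<in> carrier A\<rbrakk> \<Longrightarrow> x \<leadsto> y \<in> carrier A"
    and imp_self: "x \<in> carrier A \<Longrightarrow> x \<leadsto> x = \<one>"
    and divisibility: "\<lbrakk>x \<in> carrier A; y \<in> carrier A\<rbrakk> \<Longrightarrow> x \<otimes> (x \<leadsto> y) = y \<otimes> (y \<leadsto> x)"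
    and imp_imp: "\<lbrakk>x \<in> carrier A; y \<in> carrier A; z \<in> carrier A\<rbrakk>
                    \<Longrightarrow> x \<leadsto> (y \<leadsto> z) = (x \<otimes> y) \<leadsto> z"

locale conucleus = hoop A for A (structure) +
  fixes \<delta> :: "'a \<Rightarrow> 'a"
  assumes maps: "\<delta> \<in> carrier A \<rightarrow> carrier A"
    and contracting: "a \<in> carrier A \<Longrightarrow> \<delta> a \<preceq> a"
    and monotone: "\<lbrakk>a \<in> carrier A; b \<in> carrier A; a \<preceq> b\<rbrakk> \<Longrightarrow> \<delta> a \<preceq> \<delta> b"
    and idempotent: "a \<in> carrier A \<Longrightarrow> \<delta> (\<delta> a) = \<delta> a"
    and submultiplicative: "\<lbrakk>a \<in> carrier A; b \<in> carrier A\<rbrakk> \<Longrightarrow> \<delta> a \<otimes> \<delta> b \<preceq> \<delta> (a \<otimes> b)"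
    and unital: "a \<in> carrier A \<Longrightarrow> \<delta> a \<otimes> \<delta> \<one> = \<delta> a"

definition conuclear_image :: "('a, 'm) hoop_algebra_scheme \<Rightarrow> ('a \<Rightarrow> 'a) \<Rightarrow> 'a hoop_algebra"
  where "conuclear_image A \<delta> =
    \<lparr>carrier = \<delta> ` carrier A, mult = mult A, one = \<delta> \<one>\<^bsub>A\<^esub>, imp = (\<lambda>a b. \<delta> (a \<leadsto>\<^bsub>A\<^esub> b))\<rparr>"

text \<open>
  Homomorphisms and isomorphisms only refer to the language, not to the hoop axioms, since a
  conuclear image need not be a hoop.
\<close>

definition hoop_hom ::
  "('a, 'm) hoop_algebra_scheme \<Rightarrow> ('b, 'n) hoop_algebra_scheme \<Rightarrow> ('a \<Rightarrow> 'b) set"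
  where "hoop_hom A B = {h \<in> hom A B. h \<one>\<^bsub>A\<^esub> = \<one>\<^bsub>B\<^esub> \<and>
    (\<forall>x\<in>carrier A. \<forall>y\<in>carrier A. h (x \<leadsto>\<^bsub>A\<^esub> y) = h x \<leadsto>\<^bsub>B\<^esub> h y)}"

definition hoop_isomorphic ::
  "('a, 'm) hoop_algebra_scheme \<Rightarrow> ('b, 'n) hoop_algebra_scheme \<Rightarrow> bool"
  where "hoop_isomorphic A B \<longleftrightarrow> (\<exists>h\<in>hoop_hom A B. bij_betw h (carrier A) (carrier B))"

definition hoop_congruence :: "('a, 'm) hoop_algebra_scheme \<Rightarrow> ('a \<times> 'a) set \<Rightarrow> bool"
  where "hoop_congruence A \<theta> \<longleftrightarrow> equiv (carrier A) \<theta> \<and>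
    (\<forall>(a, a')\<in>\<theta>. \<forall>(b, b')\<in>\<theta>.
       (a \<otimes>\<^bsub>A\<^esub> b, a' \<otimes>\<^bsub>A\<^esub> b') \<in> \<theta> \<and> (a \<leadsto>\<^bsub>A\<^esub> b, a' \<leadsto>\<^bsub>A\<^esub> b') \<in> \<theta>)"

text \<open>
  The unions below run over all representatives; if \<open>\<theta>\<close> is a congruence, every choice of
  representatives yields the same class.
\<close>

definition quotient_algebra ::
  "('a, 'm) hoop_algebra_scheme \<Rightarrow> ('a \<times> 'a) set \<Rightarrow> 'a set hoop_algebra"
  where "quotient_algebra A \<theta> =
    \<lparr>carrier = carrier A // \<theta>,
     mult = (\<lambda>X Y. \<Union>x\<in>X. \<Union>y\<in>Y. \<theta> `` {x \<otimes>\<^bsub>A\<^esub> y}),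
     one = \<theta> `` {\<one>\<^bsub>A\<^esub>},
     imp = (\<lambda>X Y. \<Union>x\<in>X. \<Union>y\<in>Y. \<theta> `` {x \<leadsto>\<^bsub>A\<^esub> y})\<rparr>"

definition hoop_kernel :: "('a, 'm) hoop_algebra_scheme \<Rightarrow> ('a \<Rightarrow> 'b) \<Rightarrow> ('a \<times> 'a) set"
  where "hoop_kernel A h = {(a, b). a \<in> carrier A \<and> b \<in> carrier A \<and> h a = h b}"

definition hoop_filter :: "('a, 'm) hoop_algebra_scheme \<Rightarrow> 'a set \<Rightarrow> bool"
  where "hoop_filter A F \<longleftrightarrow> F \<subseteq> carrier A \<and> F \<noteq> {} \<and>
    (\<forall>a\<in>F. \<forall>b\<in>carrier A. a \<preceq>\<^bsub>A\<^esub> b \<longrightarrow> b \<in> F) \<and>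
    (\<forall>a\<in>F. \<forall>b\<in>F. a \<otimes>\<^bsub>A\<^esub> b \<in> F)"

definition congruence_filter :: "('a, 'm) hoop_algebra_scheme \<Rightarrow> ('a \<times> 'a) set \<Rightarrow> 'a set"
  where "congruence_filter A \<theta> = \<theta> `` {\<one>\<^bsub>A\<^esub>}"

end

theory Submission
  imports Defs
begin

text \<open>
  Put \<open>e = \<delta> \<top>\<close>, an idempotent. In a hoop, multiplying by an idempotent \<open>e\<close> is taking the meet
  with \<open>e\<close>, since \<open>e \<cdot> (e \<rightarrow> x) = e \<cdot> e \<cdot> (e \<rightarrow> x) \<le> e \<cdot> x\<close>; this makes \<open>a \<mapsto> a \<cdot> e\<close> compatible with the
  implication. Conversely, if \<open>\<delta>\<close> is a homomorphism, then
  \<open>e = \<delta> (\<delta> a \<rightarrow> \<delta> (\<delta> a)) = \<delta> (a \<rightarrow> \<delta> a) \<le> a \<rightarrow> \<delta> a\<close>, so \<open>a \<cdot> e \<le> \<delta> a\<close>.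
\<close>

section \<open>Arithmetic and order in a hoop\<close>

context hoop
begin

text \<open>The axioms state neither that \<open>\<one>\<close> is a left unit of the implication
  nor that it is the greatest element. Both follow once \<open>p = x \<leadsto> \<one>\<close> is
  shown to satisfy \<open>x \<otimes> p = x\<close>.\<close>

lemma one_imp_and_imp_one:
  assumes x: "x \<in> carrier A"
  shows "\<one> \<leadsto> x = x" and "x \<leadsto> \<one> = \<one>"
proof -
  define p where "p = x \<leadsto> \<one>"
  have p: "p \<in> carrier A" using x by (simp add: p_def imp_closed)
  have one_imp: "\<one> \<leadsto> y = y \<otimes> (y \<leadsto> \<one>)" if "y \<in> carrier A" for y
    using divisibility[of \<one> y] that by (simp add: imp_closed)
  have "p \<otimes> (p \<leadsto> \<one>) = \<one> \<leadsto> p" using one_imp p by simp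
  also have "\<dots> = p" using imp_imp[of \<one> x \<one>] x by (simp add: p_def)
  finally have pp: "p \<otimes> (p \<leadsto> \<one>) = p" .
  \<comment> \<open>Both implications between \<open>x\<close> and
    \<open>\<one> \<leadsto> x\<close> are computed, so that divisibility for this pair reads
    \<open>x = (x \<otimes> p) \<otimes> (p \<leadsto> \<one>)\<close>.\<close>
  have "x \<leadsto> (\<one> \<leadsto> x) = \<one>" using imp_imp[of x \<one> x] x by (simp add: imp_self)
  moreover have "(\<one> \<leadsto> x) \<leadsto> x = p \<leadsto> \<one>"
    using imp_imp[of p x x] x p by (simp add: one_imp m_comm imp_self flip: p_def)
  ultimately have "x = (x \<otimes> p) \<otimes> (p \<leadsto> \<one>)"
    using divisibility[of x "\<one> \<leadsto> x"] x p by (simp add: imp_closed one_imp flip: p_def)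
  also have "\<dots> = x \<otimes> p" using x p pp by (simp add: m_assoc imp_closed)
  finally have xp: "x \<otimes> p = x" by simp
  then show "\<one> \<leadsto> x = x" using one_imp x by (simp add: p_def)
  have "x \<leadsto> \<one> = (p \<otimes> x) \<leadsto> \<one>" using xp x p by (simp add: m_comm)
  also have "\<dots> = p \<leadsto> p" using imp_imp[of p x \<one>] x p by (simp add: p_def)
  finally show "x \<leadsto> \<one> = \<one>" using p by (simp add: imp_self)
qed

lemma hoop_le_refl: "x \<in> carrier A \<Longrightarrow> x \<preceq> x"
  by (simp add: hoop_le_def imp_self)

lemma hoop_le_one: "x \<in> carrier A \<Longrightarrow> x \<preceq> \<one>"
  by (simp add: hoop_le_def one_imp_and_imp_one)

lemma hoop_le_antisym:
  "\<lbrakk>x \<preceq> y; y \<preceq> x; x \<in> carrier A; y \<in> carrier A\<rbrakk> \<Longrightarrow> x = y"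
  using divisibility[of x y] by (simp add: hoop_le_def)

text \<open>Under \<open>x \<preceq> y\<close>, divisibility factors \<open>x\<close> as
  \<open>y \<otimes> (y \<leadsto> x)\<close>; currying then turns \<open>x \<leadsto> z\<close>
  into an implication with consequent \<open>y \<leadsto> z\<close>, which is
  \<open>\<one>\<close>.\<close>

lemma hoop_le_trans:
  assumes "x \<preceq> y" "y \<preceq> z" and [simp]: "x \<in> carrier A" "y \<in> carrier A" "z \<in> carrier A"
  shows "x \<preceq> z"
proof -
  have "x = y \<otimes> (y \<leadsto> x)"
    using divisibility[of x y] assms by (simp add: hoop_le_def)
  then have "x \<leadsto> z = (y \<leadsto> x) \<leadsto> (y \<leadsto> z)"
    by (simp add: imp_imp imp_closed m_comm)
  then show ?thesis using assms by (simp add: hoop_le_def one_imp_and_imp_one imp_closed)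
qed

lemma residuation:
  "\<lbrakk>x \<in> carrier A; y \<in> carrier A; z \<in> carrier A\<rbrakk> \<Longrightarrow> x \<otimes> y \<preceq> z \<longleftrightarrow> x \<preceq> y \<leadsto> z"
  by (simp add: hoop_le_def imp_imp)

lemma mult_mono_left:
  assumes "x \<preceq> y" and [simp]: "x \<in> carrier A" "y \<in> carrier A" "z \<in> carrier A"
  shows "x \<otimes> z \<preceq> y \<otimes> z"
proof -
  have "y \<preceq> z \<leadsto> (y \<otimes> z)" by (simp add: hoop_le_refl flip: residuation)
  then have "x \<preceq> z \<leadsto> (y \<otimes> z)" using hoop_le_trans assms(1) by (simp add: imp_closed)
  then show ?thesis by (simp add: residuation)
qed

lemma mult_mono:
  assumes "x \<preceq> y" "z \<preceq> w"
    and [simp]: "x \<in> carrier A" "y \<in> carrier A" "z \<in> carrier A" "w \<in> carrier A"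
  shows "x \<otimes> z \<preceq> y \<otimes> w"
proof (rule hoop_le_trans)
  show "x \<otimes> z \<preceq> y \<otimes> z" using assms by (simp add: mult_mono_left)
  show "y \<otimes> z \<preceq> y \<otimes> w"
    using mult_mono_left[of z w y] assms by (simp add: m_comm)
qed simp_all

lemma mult_le_right: "\<lbrakk>x \<in> carrier A; y \<in> carrier A\<rbrakk> \<Longrightarrow> x \<otimes> y \<preceq> y"
  using mult_mono_left[of x \<one> y] by (simp add: hoop_le_one)

lemma imp_mult_le:
  assumes [simp]: "x \<in> carrier A" "y \<in> carrier A"
  shows "(x \<leadsto> y) \<otimes> x \<preceq> y"
  by (simp add: residuation hoop_le_refl imp_closed)

section \<open>Multiplication by an idempotent\<close>

lemma idempotent_mult_imp:
  assumes ee: "e \<otimes> e = e" and [simp]: "e \<in> carrier A" "x \<in> carrier A"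
  shows "e \<otimes> (e \<leadsto> x) = e \<otimes> x"
proof (rule hoop_le_antisym)
  have "e \<otimes> (e \<leadsto> x) = ((e \<leadsto> x) \<otimes> e) \<otimes> e"
    using ee by (simp add: m_assoc m_comm[of e "e \<leadsto> x"] imp_closed)
  also have "\<dots> \<preceq> x \<otimes> e"
    by (rule mult_mono_left) (simp_all add: imp_mult_le imp_closed)
  finally show "e \<otimes> (e \<leadsto> x) \<preceq> e \<otimes> x" by (simp add: m_comm)
  \<comment> \<open>The reverse inequality rests on the residuated form of
    \<open>x \<otimes> e \<preceq> x\<close>.\<close>
  have "x \<preceq> e \<leadsto> x" using mult_le_right[of e x] by (simp add: m_comm flip: residuation)
  then show "e \<otimes> x \<preceq> e \<otimes> (e \<leadsto> x)"
    by (intro mult_mono) (simp_all add: hoop_le_refl imp_closed)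
qed (simp_all add: imp_closed)

text \<open>With \<open>\<delta> a = a \<otimes> e\<close> this becomes preservation of the
  implication. The \<open>e\<close> in the antecedent curries out and is absorbed by the outer
  \<open>e\<close>; the one in the consequent is removed by two inequalities.\<close>

lemma idempotent_mult_imp_mult:
  assumes ee: "e \<otimes> e = e" and [simp]: "e \<in> carrier A" "a \<in> carrier A" "b \<in> carrier A"
  shows "e \<otimes> ((a \<otimes> e) \<leadsto> (b \<otimes> e)) = e \<otimes> (a \<leadsto> b)"
proof -
  have "e \<otimes> ((a \<otimes> e) \<leadsto> (b \<otimes> e)) = e \<otimes> (e \<leadsto> (a \<leadsto> (b \<otimes> e)))"
    by (simp add: imp_imp m_comm)
  also have "\<dots> = e \<otimes> (a \<leadsto> (b \<otimes> e))"
    using ee by (simp add: idempotent_mult_imp imp_closed)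
  also have "\<dots> = e \<otimes> (a \<leadsto> b)"
  proof (rule hoop_le_antisym)
    have "(a \<leadsto> (b \<otimes> e)) \<otimes> a \<preceq> b \<otimes> e" by (simp add: imp_mult_le)
    moreover have "b \<otimes> e \<preceq> b" using mult_le_right[of e b] by (simp add: m_comm)
    ultimately have "(a \<leadsto> (b \<otimes> e)) \<otimes> a \<preceq> b"
      by (rule hoop_le_trans) (simp_all add: imp_closed)
    then have "a \<leadsto> (b \<otimes> e) \<preceq> a \<leadsto> b" by (simp add: residuation imp_closed)
    then show "e \<otimes> (a \<leadsto> (b \<otimes> e)) \<preceq> e \<otimes> (a \<leadsto> b)"
      by (intro mult_mono) (simp_all add: hoop_le_refl imp_closed)
    have "((a \<leadsto> b) \<otimes> a) \<otimes> e \<preceq> b \<otimes> e"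
      by (intro mult_mono_left) (simp_all add: imp_mult_le imp_closed)
    then have "((a \<leadsto> b) \<otimes> e) \<otimes> a \<preceq> b \<otimes> e"
      by (simp add: m_assoc imp_closed m_comm[of e a])
    then have "(a \<leadsto> b) \<otimes> e \<preceq> a \<leadsto> (b \<otimes> e)" by (simp add: residuation imp_closed)
    \<comment> \<open>One factor \<open>e\<close> has gone into the consequent. A second copy
      supplies the outer \<open>e\<close> on the right, and idempotence merges the two on the
      left.\<close>
    then have "((a \<leadsto> b) \<otimes> e) \<otimes> e \<preceq> (a \<leadsto> (b \<otimes> e)) \<otimes> e"
      by (intro mult_mono_left) (simp_all add: imp_closed)
    then show "e \<otimes> (a \<leadsto> b) \<preceq> e \<otimes> (a \<leadsto> (b \<otimes> e))"
      by (simp add: m_assoc ee imp_closed m_comm[of e "a \<leadsto> _"])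
  qed (simp_all add: imp_closed)
  finally show ?thesis .
qed

section \<open>Filters, kernels and quotients\<close>

lemma hoop_filter_upset:
  assumes ee: "e \<otimes> e = e" and e: "e \<in> carrier A"
  shows "hoop_filter A {a \<in> carrier A. e \<preceq> a}"
  unfolding hoop_filter_def
proof (intro conjI ballI impI)
  show "{a \<in> carrier A. e \<preceq> a} \<noteq> {}" using e hoop_le_refl by auto
next
  fix a b assume "a \<in> {a \<in> carrier A. e \<preceq> a}" "b \<in> carrier A" "a \<preceq> b"
  then show "b \<in> {a \<in> carrier A. e \<preceq> a}" using e hoop_le_trans[of e a b] by auto
next
  fix a b assume "a \<in> {a \<in> carrier A. e \<preceq> a}" "b \<in> {a \<in> carrier A. e \<preceq> a}"
  \<comment> \<open>Idempotence gives
    \<open>e = e \<otimes> e \<preceq> a \<otimes> b\<close>.\<close>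
  then show "a \<otimes> b \<in> {a \<in> carrier A. e \<preceq> a}" using e ee mult_mono[of e a e b] by auto
qed auto

lemma hoop_congruence_kernel:
  assumes "h \<in> hoop_hom A B"
  shows "hoop_congruence A (hoop_kernel A h)"
  unfolding hoop_congruence_def
proof
  show "equiv (carrier A) (hoop_kernel A h)"
    by (rule equivI) (auto simp: hoop_kernel_def refl_on_def sym_on_def trans_on_def)
qed (use assms in \<open>auto simp: hoop_kernel_def hoop_hom_def hom_def imp_closed\<close>)

text \<open>The first isomorphism theorem. \<open>B\<close> ranges over all algebras of the
  language, so that it can be a conuclear image, which may fail to be a hoop.\<close>

theorem quotient_kernel_isomorphic:
  assumes h: "h \<in> hoop_hom A B" and onto: "h ` carrier A = carrier B"
  shows "hoop_isomorphic (quotient_algebra A (hoop_kernel A h)) B"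
proof -
  let ?K = "hoop_kernel A h"
  let ?Q = "quotient_algebra A ?K"
  \<comment> \<open>\<open>h\<close> is constant on each kernel class, so its image there is a
    singleton, and \<open>the_elem\<close> extracts the common value.\<close>
  let ?g = "\<lambda>X. the_elem (h ` X)"
  have cls: "?K `` {x} = {y \<in> carrier A. h y = h x}" if "x \<in> carrier A" for x
    using that by (auto simp: hoop_kernel_def)
  have g: "?g (?K `` {x}) = h x" if "x \<in> carrier A" for x
  proof -
    have "h ` (?K `` {x}) = {h x}" using that by (auto simp: cls)
    then show ?thesis by simp
  qed
  have carr: "carrier ?Q = (\<lambda>x. ?K `` {x}) ` carrier A"
    by (auto simp: quotient_algebra_def quotient_def)
  \<comment> \<open>The union over representatives collapses: \<open>h\<close> preserves the
    operation, so all products lie in one class.\<close>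
  have mult: "?K `` {x} \<otimes>\<^bsub>?Q\<^esub> ?K `` {y} = ?K `` {x \<otimes> y}"
    if "x \<in> carrier A" "y \<in> carrier A" for x y
    using that h by (auto simp: quotient_algebra_def cls hoop_hom_def hom_def)
  have imp: "?K `` {x} \<leadsto>\<^bsub>?Q\<^esub> ?K `` {y} = ?K `` {x \<leadsto> y}"
    if "x \<in> carrier A" "y \<in> carrier A" for x y
    using that h by (auto simp: quotient_algebra_def cls hoop_hom_def imp_closed)
  have "?g \<in> hoop_hom ?Q B"
    using h onto
    by (auto simp: hoop_hom_def hom_def carr g mult imp imp_closed)
       \<comment> \<open>What remains is the unit, the class of \<open>\<one>\<close>.\<close>
       (simp add: quotient_algebra_def g)
  moreover have "bij_betw ?g (carrier ?Q) (carrier B)"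
    unfolding bij_betw_def
  proof
    show "inj_on ?g (carrier ?Q)"
      by (rule inj_onI, unfold carr, elim imageE) (simp add: g, simp add: cls)
    show "?g ` carrier ?Q = carrier B"
      by (simp add: carr image_image g onto)
  qed
  ultimately show ?thesis unfolding hoop_isomorphic_def by blast
qed

end

section \<open>Conuclei and their images\<close>

context conucleus
begin

lemma \<delta>_closed [simp]: "a \<in> carrier A \<Longrightarrow> \<delta> a \<in> carrier A"
  using maps by auto

text \<open>If \<open>\<delta> \<one> \<preceq> a\<close>, then monotonicity and idempotence give
  \<open>\<delta> \<one> \<preceq> \<delta> a\<close>, while \<open>a \<preceq> \<one>\<close> gives
  the reverse; contraction yields the converse implication.\<close>

lemma congruence_filter_kernel:
  "congruence_filter A (hoop_kernel A \<delta>) = {a \<in> carrier A. \<delta> \<one> \<preceq> a}"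
proof -
  have "\<delta> a = \<delta> \<one> \<longleftrightarrow> \<delta> \<one> \<preceq> a" if a: "a \<in> carrier A" for a
  proof
    assume "\<delta> a = \<delta> \<one>"
    then show "\<delta> \<one> \<preceq> a" using contracting[OF a] by simp
  next
    assume "\<delta> \<one> \<preceq> a"
    then have "\<delta> \<one> \<preceq> \<delta> a" using monotone[of "\<delta> \<one>" a] a by (simp add: idempotent)
    moreover have "\<delta> a \<preceq> \<delta> \<one>" using a by (simp add: monotone hoop_le_one)
    ultimately show "\<delta> a = \<delta> \<one>" using a by (simp add: hoop_le_antisym)
  qed
  then show ?thesis by (force simp: congruence_filter_def hoop_kernel_def)
qed

lemma hoop_hom_if_mult:
  assumes *: "\<And>a. a \<in> carrier A \<Longrightarrow> \<delta> a = a \<otimes> \<delta> \<one>"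
  shows "\<delta> \<in> hoop_hom A (conuclear_image A \<delta>)"
proof -
  define e where "e = \<delta> \<one>"
  have [simp]: "e \<in> carrier A" by (simp add: e_def)
  have ee: "e \<otimes> e = e" using unital[of \<one>] by (simp add: e_def)
  have \<delta>: "\<delta> a = a \<otimes> e" if "a \<in> carrier A" for a using *[OF that] by (simp only: e_def)
  have "\<delta> (a \<otimes> b) = \<delta> a \<otimes> \<delta> b" if "a \<in> carrier A" "b \<in> carrier A" for a b
  proof -
    \<comment> \<open>Idempotence doubles \<open>e\<close>, leaving one copy for each
      factor.\<close>
    have "\<delta> (a \<otimes> b) = (a \<otimes> b) \<otimes> (e \<otimes> e)" using that ee \<delta> by simp
    also have "\<dots> = (a \<otimes> e) \<otimes> (b \<otimes> e)" using that by (simp add: m_ac)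
    finally show ?thesis using that \<delta> by simp
  qed
  \<comment> \<open>The outer \<open>\<delta>\<close> on the right belongs to the implication of the
    image algebra.\<close>
  moreover have "\<delta> (a \<leadsto> b) = \<delta> (\<delta> a \<leadsto> \<delta> b)" if "a \<in> carrier A" "b \<in> carrier A" for a b
  proof -
    have "\<delta> (a \<leadsto> b) = e \<otimes> (a \<leadsto> b)" using that by (simp add: \<delta> imp_closed m_comm[of e])
    also have "\<dots> = e \<otimes> (\<delta> a \<leadsto> \<delta> b)"
      using idempotent_mult_imp_mult[OF ee, of a b] that \<delta> by simp
    also have "\<dots> = \<delta> (\<delta> a \<leadsto> \<delta> b)"
      using \<delta>[of "\<delta> a \<leadsto> \<delta> b"] that by (simp add: imp_closed m_comm)
    finally show ?thesis .
  qed
  ultimately show ?thesis by (auto simp: hoop_hom_def hom_def conuclear_image_def)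
qed

lemma mult_if_hoop_hom:
  assumes hom: "\<delta> \<in> hoop_hom A (conuclear_image A \<delta>)" and a: "a \<in> carrier A"
  shows "\<delta> a = a \<otimes> \<delta> \<one>"
proof (rule hoop_le_antisym)
  \<comment> \<open>Unitality rewrites the left side as
    \<open>\<delta> a \<otimes> \<delta> \<one>\<close>, and contraction replaces
    \<open>\<delta> a\<close> by \<open>a\<close>.\<close>
  show "\<delta> a \<preceq> a \<otimes> \<delta> \<one>"
    using mult_mono_left[OF contracting[OF a], of "\<delta> \<one>"] a by (simp add: unital)
  have "\<delta> (a \<leadsto> \<delta> a) = \<delta> (\<delta> a \<leadsto> \<delta> (\<delta> a))"
    using hom a by (simp add: hoop_hom_def conuclear_image_def)
  also have "\<dots> = \<delta> \<one>" using a by (simp add: idempotent imp_self)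
  finally have "\<delta> \<one> \<preceq> a \<leadsto> \<delta> a" using contracting[of "a \<leadsto> \<delta> a"] a by (simp add: imp_closed)
  then show "a \<otimes> \<delta> \<one> \<preceq> \<delta> a" using a by (simp add: m_comm flip: residuation)
qed (use a in simp_all)

end

theorem theorem3p8:
  fixes A :: "'a hoop_algebra" and \<delta> :: "'a \<Rightarrow> 'a"
  assumes "hoop A" and "conucleus A \<delta>"
  shows "((\<forall>a\<in>carrier A. \<delta> a = a \<otimes>\<^bsub>A\<^esub> \<delta> \<one>\<^bsub>A\<^esub>) \<longleftrightarrow>
          (\<delta> \<in> hoop_hom A (conuclear_image A \<delta>) \<and>
           \<delta> ` carrier A = carrier (conuclear_image A \<delta>))) \<and>
         ((\<forall>a\<in>carrier A. \<delta> a = a \<otimes>\<^bsub>A\<^esub> \<delta> \<one>\<^bsub>A\<^esub>) \<longrightarrow>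
           hoop_congruence A (hoop_kernel A \<delta>) \<and>
           hoop_isomorphic (quotient_algebra A (hoop_kernel A \<delta>)) (conuclear_image A \<delta>) \<and>
           hoop_filter A (congruence_filter A (hoop_kernel A \<delta>)) \<and>
           congruence_filter A (hoop_kernel A \<delta>) = {a \<in> carrier A. \<delta> \<one>\<^bsub>A\<^esub> \<preceq>\<^bsub>A\<^esub> a})"
proof -
  interpret conucleus A \<delta> by fact
  \<comment> \<open>Surjectivity is built into the carrier of the image, so (ii) reduces to being a
    homomorphism.\<close>
  have onto: "\<delta> ` carrier A = carrier (conuclear_image A \<delta>)"
    by (simp add: conuclear_image_def)
  have "hoop_filter A {a \<in> carrier A. \<delta> \<one>\<^bsub>A\<^esub> \<preceq>\<^bsub>A\<^esub> a}"
    using unital[of "\<one>\<^bsub>A\<^esub>"] by (intro hoop_filter_upset) simp_all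
  moreover have "\<delta> \<in> hoop_hom A (conuclear_image A \<delta>) \<longleftrightarrow>
      (\<forall>a\<in>carrier A. \<delta> a = a \<otimes>\<^bsub>A\<^esub> \<delta> \<one>\<^bsub>A\<^esub>)"
    using hoop_hom_if_mult mult_if_hoop_hom by blast
  moreover note hoop_congruence_kernel[of \<delta> "conuclear_image A \<delta>"]
    quotient_kernel_isomorphic[OF _ onto]
  ultimately show ?thesis unfolding congruence_filter_kernel using onto by blast
qed

end
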